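(* Let $m\ge 1$, let $\Gamma\le S_m$ and let $a_1,\dots,a_m\ge 2$ be integers. Let $O_1,\dots,O_t$ be the orbits of the action of $\Gamma$ on $[m]=\{1,\dots,m\}$, and write $O_i=\{c_{1,i},c_{2,i},\dots,c_{|O_i|,i}\}$. For each $i$, let $n_i=R_{\Gamma|_{O_i}}(a_{c_{1,i}},a_{c_{2,i}},\dots,a_{c_{|O_i|,i}})$. Then \[R_\Gamma(a_1,a_2,\dots,a_m)\le R(n_1,n_2,\dots,n_t).\]
   Context: An $m$-edge-coloured complete graph is a complete graph together with a colouring $c$ of its edges by colours from $[m]=\{1,\dots,m\}$. For $\Gamma\le S_m$, $\pi\in\Gamma$ and a vertex $v$, switching at $v$ with $\pi$ recolours every edge incident with $v$ of colour $i$ to colour $\pi(i)$ (for all $i$), leaving all other edges unchanged. Two $m$-edge-coloured complete graphs on the same vertex set are $\Gamma$-switch equivalent if one is obtained from the other by a finite sequence of such switches (vertices and group elements may repeat). $K_t^{(i)}$ denotes a complete graph on $t$ vertices all of whose edges have colour $i$. For integers $a_1,\dots,a_m\ge2$, the $\Gamma$-switch Ramsey number $R_\Gamma(a_1,\dots,a_m)$ is the least integer $n$ such that every $m$-edge-coloured complete graph on $n$ vertices is $\Gamma$-switch equivalent to one that contains, for some $1\le i\le m$, a copy of $K_{a_i}^{(i)}$. $R(\cdot)$ denotes the classical multicolour Ramsey number. For an orbit $O=\{c_1,\dots,c_k\}$ of $\Gamma$ on $[m]$, $\Gamma|_O$ denotes the group of permutations of $O$ obtained by restricting the elements of $\Gamma$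 to $O$, regarded as a subgroup of $S_k$ via the identification $c_j\leftrightarrow j$; so $R_{\Gamma|_O}(a_{c_1},\dots,a_{c_k})$ is the switch Ramsey number for $k$-edge-coloured complete graphs with colours $c_1,\dots,c_k$ and switching by $\Gamma|_O$. *)

theory Defs
  imports "HOL-Library.Ramsey" "HOL-Algebra.Sym_Groups" "HOL-Algebra.Group_Action"
begin

text \<open>
  The edges of the complete graph on \<open>V\<close> are the two-element subsets of \<open>V\<close>. Colourings are
  extensional (\<open>undefined\<close> off the edges), so that equality of functions is equality of
  edge-coloured graphs.
\<close>

definition edge_colourings :: "nat \<Rightarrow> 'v set \<Rightarrow> ('v set \<Rightarrow> nat) set" where
  "edge_colourings m V = nsets V 2 \<rightarrow>\<^sub>E {1..m}"

definition switch :: "'v set \<Rightarrow> 'v \<Rightarrow> (nat \<Rightarrow> nat) \<Rightarrow> ('v set \<Rightarrow> nat) \<Rightarrow> 'v set \<Rightarrow> nat" where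
  "switch V v \<pi> f = (\<lambda>e \<in> nsets V 2. if v \<in> e then \<pi> (f e) else f e)"

definition switch_equiv ::
    "'v set \<Rightarrow> (nat \<Rightarrow> nat) set \<Rightarrow> ('v set \<Rightarrow> nat) \<Rightarrow> ('v set \<Rightarrow> nat) \<Rightarrow> bool" where
  "switch_equiv V \<Gamma> = (\<lambda>f g. \<exists>v\<in>V. \<exists>\<pi>\<in>\<Gamma>. g = switch V v \<pi> f)\<^sup>*\<^sup>*"

text \<open>
  The library predicate \<^term>\<open>monochromatic V k 2 g i\<close> says that some \<open>k\<close>-subset of \<open>V\<close> has all
  its edges of colour \<open>i\<close>, i.e. that \<open>g\<close> contains a copy of the complete graph on \<open>k\<close> vertices
  in colour \<open>i\<close>. Both minima below are over nonempty sets of naturals whenever there is at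
  least one colour, by the theorem \<open>ramsey_full\<close> (no switches are needed in the first case).
\<close>

definition switch_ramsey :: "nat \<Rightarrow> (nat \<Rightarrow> nat) set \<Rightarrow> (nat \<Rightarrow> nat) \<Rightarrow> nat" where
  "switch_ramsey m \<Gamma> a = (LEAST n. \<forall>V :: nat set. finite V \<and> card V = n \<longrightarrow>
     (\<forall>f \<in> edge_colourings m V. \<exists>g. switch_equiv V \<Gamma> f g \<and>
        (\<exists>i\<in>{1..m}. monochromatic V (a i) 2 g i)))"

text \<open>
  The classical Ramsey number \<open>R(b\<^sub>1, \<dots>, b\<^sub>t)\<close>; \<^const>\<open>partn_lst\<close> numbers the colours from \<open>0\<close>.
\<close>

definition ramsey_number :: "nat \<Rightarrow> (nat \<Rightarrow> nat) \<Rightarrow> nat" where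
  "ramsey_number t b = (LEAST n. partn_lst {..<n} (map b [1..<Suc t]) 2)"

text \<open>
  For an enumeration \<open>c\<close> of an orbit by \<open>{1..k}\<close>: the restriction of \<open>\<Gamma>\<close> to this orbit, as a set of
  permutations of \<open>{1..k}\<close> via the identification of \<open>c j\<close> with \<open>j\<close>.
\<close>

definition restricted_group :: "(nat \<Rightarrow> nat) set \<Rightarrow> nat \<Rightarrow> (nat \<Rightarrow> nat) \<Rightarrow> (nat \<Rightarrow> nat) set" where
  "restricted_group \<Gamma> k c =
     {p. p permutes {1..k} \<and> (\<exists>\<pi>\<in>\<Gamma>. \<forall>j\<in>{1..k}. c (p j) = \<pi> (c j))}"

end

theory Submission
  imports Defs
begin

text \<open>
  Merge the colours of each orbit into one and apply the classical Ramsey theorem to obtain a set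
  of \<open>n\<^sub>i\<close> vertices whose edges all have colours in the orbit \<open>O\<^sub>i\<close>. Inside this set some sequence
  of switches by the restricted group produces a monochromatic clique. Each of these switches
  extends to a switch of the whole graph by an element of \<open>\<Gamma>\<close>, and the extension acts on the edges
  inside the set in the same way.
\<close>

text \<open>The predicate under \<open>LEAST\<close> gets a name so that \<open>LeastI\<close> and
  \<open>Least_le\<close> can be applied to it.\<close>

definition switch_ramsey_prop :: "nat \<Rightarrow> (nat \<Rightarrow> nat) set \<Rightarrow> (nat \<Rightarrow> nat) \<Rightarrow> nat \<Rightarrow> bool" where
  "switch_ramsey_prop m \<Gamma> a n \<longleftrightarrow> (\<forall>V :: nat set. finite V \<and> card V = n \<longrightarrow>
     (\<forall>f \<in> edge_colourings m V. \<exists>g. switch_equiv V \<Gamma> f g \<and>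
        (\<exists>i\<in>{1..m}. monochromatic V (a i) 2 g i)))"

lemma switch_ramsey_alt: "switch_ramsey m \<Gamma> a = (LEAST n. switch_ramsey_prop m \<Gamma> a n)"
  unfolding switch_ramsey_def switch_ramsey_prop_def ..

lemma partn_lst_ramsey_number: "partn_lst {..<ramsey_number t b} (map b [1..<Suc t]) 2"
  unfolding ramsey_number_def using ramsey_full by (rule LeastI_ex)

lemma monochromatic_bij_betw:
  assumes h: "bij_betw h A V" and mono: "monochromatic A k r (\<lambda>e. f (h ` e)) i"
  shows "monochromatic V k r f i"
proof -
  obtain H where H: "H \<in> nsets A k" and "(\<lambda>e. f (h ` e)) ` nsets H r \<subseteq> {i}"
    using mono unfolding monochromatic_def by blast
  moreover have "bij_betw h H (h ` H)"
    using H h by (auto simp: nsets_def intro: bij_betw_subset)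
  then have "nsets (h ` H) r = (`) h ` nsets H r"
    by (metis bij_betw_nsets bij_betw_imp_surj_on)
  ultimately have "f ` nsets (h ` H) r \<subseteq> {i}"
    by auto
  moreover have "h ` H \<in> nsets V k"
    using bij_betw_nsets[OF h] H by (metis bij_betwE)
  ultimately show ?thesis
    unfolding monochromatic_def by blast
qed

text \<open>Bridge to the library's form of Ramsey's theorem: \<open>partn_lst\<close> colours pairs
  from \<open>{..<N}\<close> with colours numbered from 0, so the colouring is pulled back along a
  bijection and shifted down by one.\<close>

lemma ramsey_colours_from_1:
  assumes part: "partn_lst {..<N} (map b [1..<Suc t]) 2"
    and V: "finite V" "card V = N" and f: "f \<in> nsets V 2 \<rightarrow> {1..t}"
  obtains i where "i \<in> {1..t}" "monochromatic V (b i) 2 f i"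
proof -
  obtain h where h: "bij_betw h {..<N} V"
    using ex_bij_betw_nat_finite[OF V(1)] V(2) by (auto simp: lessThan_atLeast0)
  have range: "f (h ` e) \<in> {1..t}" if "e \<in> nsets {..<N} 2" for e
    using f bij_betw_nsets[OF h] that by (metis bij_betwE PiE)
  then have "(\<lambda>e. f (h ` e) - 1) \<in> nsets {..<N} 2 \<rightarrow> {..<length (map b [1..<Suc t])}"
    by fastforce
  then obtain j where "j < length (map b [1..<Suc t])"
    and "monochromatic {..<N} (map b [1..<Suc t] ! j) 2 (\<lambda>e. f (h ` e) - 1) j"
    using part unfolding partn_lst_def by blast
  then have j: "j < t" and "monochromatic {..<N} (b (Suc j)) 2 (\<lambda>e. f (h ` e) - 1) j"
    by (simp_all del: upt_Suc)
  then obtain H where H: "H \<in> nsets {..<N} (b (Suc j))"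
    and Hj: "\<And>e. e \<in> nsets H 2 \<Longrightarrow> f (h ` e) - 1 = j"
    unfolding monochromatic_def by blast
  \<comment> \<open>Subtraction is truncated, so for \<open>j = 0\<close> the shifted colour alone
    would not exclude colour 0; the bound in \<open>range\<close> does.\<close>
  have "f (h ` e) = Suc j" if "e \<in> nsets H 2" for e
  proof -
    have "e \<in> nsets {..<N} 2"
      using H that nsets_mono[of H "{..<N}" 2] by (auto simp: nsets_def)
    then show ?thesis
      using range[of e] Hj[OF that] by (auto simp: Suc_diff_le)
  qed
  then have "monochromatic {..<N} (b (Suc j)) 2 (\<lambda>e. f (h ` e)) (Suc j)"
    using H unfolding monochromatic_def by blast
  then have "monochromatic V (b (Suc j)) 2 f (Suc j)"
    by (rule monochromatic_bij_betw[OF h])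
  then show thesis
    using j by (intro that[of "Suc j"]) auto
qed

text \<open>The minimum is attained because the classical Ramsey number already has the property,
  with the empty sequence of switches.\<close>

lemma switch_ramsey_prop_switch_ramsey: "switch_ramsey_prop m \<Gamma> a (switch_ramsey m \<Gamma> a)"
proof -
  have "switch_ramsey_prop m \<Gamma> a (ramsey_number m a)"
    unfolding switch_ramsey_prop_def
  proof (intro allI impI ballI, elim conjE)
    fix V :: "nat set" and f
    assume V: "finite V" "card V = ramsey_number m a" and f: "f \<in> edge_colourings m V"
    have "f \<in> nsets V 2 \<rightarrow> {1..m}"
      using f unfolding edge_colourings_def by blast
    then obtain i where "i \<in> {1..m}" "monochromatic V (a i) 2 f i"
      by (rule ramsey_colours_from_1[OF partn_lst_ramsey_number V])
    moreover have "switch_equiv V \<Gamma> f f"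
      unfolding switch_equiv_def by simp
    ultimately show "\<exists>g. switch_equiv V \<Gamma> f g \<and> (\<exists>i\<in>{1..m}. monochromatic V (a i) 2 g i)"
      by blast
  qed
  then show ?thesis
    unfolding switch_ramsey_alt by (rule LeastI)
qed

lemma switch_edge_colourings:
  assumes "f \<in> edge_colourings m V" and "\<pi> permutes {1..m}"
  shows "switch V v \<pi> f \<in> edge_colourings m V"
  using assms permutes_in_image[OF assms(2)]
  unfolding edge_colourings_def switch_def by (auto simp: PiE_iff)

text \<open>A switch of \<open>H\<close> at \<open>v\<close> by \<open>p\<close> is imitated by
  switching \<open>V\<close> at the same \<open>v\<close> with some \<pi> in \<Gamma> that induces
  \<open>p\<close> through \<open>c\<close>. Edges leaving \<open>H\<close> may be recoloured too,
  but the two colourings are compared only inside \<open>H\<close>.\<close>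

lemma switch_equiv_lift:
  assumes "switch_equiv H (restricted_group \<Gamma> k c) h h'" and HV: "H \<subseteq> V"
    and h: "h \<in> edge_colourings k H" and f: "\<And>e. e \<in> nsets H 2 \<Longrightarrow> f e = c (h e)"
  obtains f' where "switch_equiv V \<Gamma> f f'" "\<And>e. e \<in> nsets H 2 \<Longrightarrow> f' e = c (h' e)"
proof -
  \<comment> \<open>Membership is part of the invariant because \<open>c (p j) = \<pi> (c j)\<close>
    is known only for \<open>j\<close> in \<open>{1..k}\<close>.\<close>
  have "h' \<in> edge_colourings k H \<and>
        (\<exists>f'. switch_equiv V \<Gamma> f f' \<and> (\<forall>e \<in> nsets H 2. f' e = c (h' e)))"
    using assms(1) unfolding switch_equiv_def[of H]
  proof (induction rule: rtranclp_induct)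
    case base
    then show ?case
      using h f unfolding switch_equiv_def by blast
  next
    case (step h1 h2)
    obtain f1 where f1: "switch_equiv V \<Gamma> f f1" "\<And>e. e \<in> nsets H 2 \<Longrightarrow> f1 e = c (h1 e)"
      and h1: "h1 \<in> edge_colourings k H"
      using step.IH by blast
    obtain v p where v: "v \<in> H" and p: "p \<in> restricted_group \<Gamma> k c" and h2: "h2 = switch H v p h1"
      using step.hyps(2) by blast
    obtain \<pi> where \<pi>: "\<pi> \<in> \<Gamma>" "\<And>j. j \<in> {1..k} \<Longrightarrow> c (p j) = \<pi> (c j)"
      using p unfolding restricted_group_def by blast
    have "p permutes {1..k}"
      using p unfolding restricted_group_def by blast
    then have "h2 \<in> edge_colourings k H"
      unfolding h2 by (rule switch_edge_colourings[OF h1])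
    moreover have "switch_equiv V \<Gamma> f (switch V v \<pi> f1)"
      using f1(1) v HV \<pi>(1) unfolding switch_equiv_def
      by (blast intro: rtranclp.rtrancl_into_rtrancl)
    moreover have "switch V v \<pi> f1 e = c (h2 e)" if e: "e \<in> nsets H 2" for e
    proof -
      have "e \<in> nsets V 2" "h1 e \<in> {1..k}"
        using e nsets_mono[OF HV] h1 unfolding edge_colourings_def by blast+
      then show ?thesis
        using e f1(2)[OF e] \<pi>(2) unfolding h2 switch_def by simp
    qed
    ultimately show ?case
      by blast
  qed
  then show thesis
    using that by blast
qed

lemma orbits_sym_group_cover:
  assumes "subgroup \<Gamma> (sym_group m)" and "x \<in> {1..m}"
  obtains B where "B \<in> orbits (sym_group m\<lparr>carrier := \<Gamma>\<rparr>) {1..m} (\<lambda>\<pi>. \<pi>)" "x \<in> B"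
proof -
  have "id \<in> \<Gamma>"
    using subgroup.one_closed[OF assms(1)] by (simp add: sym_group_one)
  \<comment> \<open>The form \<open>id x\<close> is kept unsimplified: it exhibits the group element
    that places \<open>x\<close> in its own orbit.\<close>
  then have "id x \<in> orbit (sym_group m\<lparr>carrier := \<Gamma>\<rparr>) (\<lambda>\<pi>. \<pi>) x"
    unfolding orbit_def by (simp del: id_apply) blast
  then show thesis
    using that assms(2) unfolding orbits_def by auto
qed

lemma orbits_sym_group_subset:
  assumes "subgroup \<Gamma> (sym_group m)" and "B \<in> orbits (sym_group m\<lparr>carrier := \<Gamma>\<rparr>) {1..m} (\<lambda>\<pi>. \<pi>)"
  shows "B \<subseteq> {1..m}"
proof -
  have "\<pi> x \<in> {1..m}" if "\<pi> \<in> \<Gamma>" "x \<in> {1..m}" for \<pi> x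
    using that subgroup.subset[OF assms(1)] by (metis permutes_in_image subsetD sym_group_carrier)
  then show ?thesis
    using assms(2) unfolding orbits_def orbit_def by auto
qed

theorem theorem1:
  fixes m t :: nat
    and \<Gamma> :: "(nat \<Rightarrow> nat) set"
    and a n :: "nat \<Rightarrow> nat"
    and Orb :: "nat \<Rightarrow> nat set"
    and c :: "nat \<Rightarrow> nat \<Rightarrow> nat"
  assumes "m \<ge> 1"
    and "subgroup \<Gamma> (sym_group m)"
    and "\<And>i. i \<in> {1..m} \<Longrightarrow> a i \<ge> 2"
    and "bij_betw Orb {1..t} (orbits (sym_group m\<lparr>carrier := \<Gamma>\<rparr>) {1..m} (\<lambda>\<pi>. \<pi>))"
    and "\<And>i. i \<in> {1..t} \<Longrightarrow> bij_betw (c i) {1..card (Orb i)} (Orb i)"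
    and "\<And>i. i \<in> {1..t} \<Longrightarrow>
           n i = switch_ramsey (card (Orb i)) (restricted_group \<Gamma> (card (Orb i)) (c i))
                   (\<lambda>j. a (c i j))"
  shows "switch_ramsey m \<Gamma> a \<le> ramsey_number t n"
proof -
  let ?orbits = "orbits (sym_group m\<lparr>carrier := \<Gamma>\<rparr>) {1..m} (\<lambda>\<pi>. \<pi>)"
  have "switch_ramsey_prop m \<Gamma> a (ramsey_number t n)"
    unfolding switch_ramsey_prop_def
  proof (intro allI impI ballI, elim conjE)
    fix V :: "nat set" and f
    assume V: "finite V" "card V = ramsey_number t n" and f: "f \<in> edge_colourings m V"
    have "\<exists>i\<in>{1..t}. x \<in> Orb i" if "x \<in> {1..m}" for x
      using orbits_sym_group_cover[OF assms(2) that] bij_betw_imp_surj_on[OF assms(4)] by blast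
    \<comment> \<open>\<open>idx\<close> sends a colour to the index of an orbit containing it, so
      composing it with \<open>f\<close> merges the colours of each orbit.\<close>
    then obtain idx where idx: "\<And>x. x \<in> {1..m} \<Longrightarrow> idx x \<in> {1..t} \<and> x \<in> Orb (idx x)"
      by metis
    have "(\<lambda>e. idx (f e)) \<in> nsets V 2 \<rightarrow> {1..t}"
      using f idx unfolding edge_colourings_def by blast
    then obtain i where i: "i \<in> {1..t}" and mono: "monochromatic V (n i) 2 (\<lambda>e. idx (f e)) i"
      by (rule ramsey_colours_from_1[OF partn_lst_ramsey_number V])
    then obtain H where H: "finite H" "card H = n i" "H \<subseteq> V"
      and Hi: "\<And>e. e \<in> nsets H 2 \<Longrightarrow> idx (f e) = i"
      unfolding monochromatic_def by (auto simp: nsets_def[of V])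
    define k where "k = card (Orb i)"
    have c: "bij_betw (c i) {1..k} (Orb i)"
      using assms(5)[OF i] unfolding k_def .
    \<comment> \<open>The colours on \<open>H\<close> are pulled back along the enumeration of the
      orbit, which makes them a colouring by \<open>{1..k}\<close>, the colours on which the
      restricted group acts.\<close>
    define h where "h = (\<lambda>e \<in> nsets H 2. inv_into {1..k} (c i) (f e))"
    have fOrb: "f e \<in> Orb i" if "e \<in> nsets H 2" for e
    proof -
      have "f e \<in> {1..m}"
        using f that nsets_mono[OF H(3)] unfolding edge_colourings_def by blast
      then show ?thesis
        using idx Hi[OF that] by metis
    qed
    have h: "h \<in> edge_colourings k H"
      using fOrb bij_betwE[OF bij_betw_inv_into[OF c]]
      unfolding h_def edge_colourings_def by auto
    have fh: "f e = c i (h e)" if "e \<in> nsets H 2" for e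
      using fOrb[OF that] that bij_betw_inv_into_right[OF c] unfolding h_def by simp
    \<comment> \<open>The clique size \<open>n i\<close> was chosen as the switch Ramsey number for
      this orbit, so the property applies to \<open>H\<close> itself.\<close>
    have "switch_ramsey_prop k (restricted_group \<Gamma> k (c i)) (\<lambda>j. a (c i j)) (n i)"
      using switch_ramsey_prop_switch_ramsey assms(6)[OF i] unfolding k_def by metis
    then obtain h' j where h': "switch_equiv H (restricted_group \<Gamma> k (c i)) h h'"
      and j: "j \<in> {1..k}" and mono': "monochromatic H (a (c i j)) 2 h' j"
      using H h unfolding switch_ramsey_prop_def by blast
    obtain f' where f': "switch_equiv V \<Gamma> f f'" "\<And>e. e \<in> nsets H 2 \<Longrightarrow> f' e = c i (h' e)"
      using switch_equiv_lift[OF h' H(3) h fh] by blast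
    obtain K where K: "K \<in> nsets H (a (c i j))" "\<And>e. e \<in> nsets K 2 \<Longrightarrow> h' e = j"
      using mono' unfolding monochromatic_def by blast
    \<comment> \<open>Inside \<open>H\<close> the lifted colouring is \<open>c i\<close> after
      \<open>h'\<close>, so colour \<open>j\<close> on \<open>K\<close> becomes
      \<open>c i j\<close>; the size of \<open>K\<close> is the one required for that
      colour.\<close>
    have "nsets K 2 \<subseteq> nsets H 2"
      using K(1) by (intro nsets_mono) (simp add: nsets_def)
    then have "f' ` nsets K 2 \<subseteq> {c i j}"
      using K(2) f'(2) by auto
    then have "monochromatic V (a (c i j)) 2 f' (c i j)"
      using K(1) nsets_mono[OF H(3)] unfolding monochromatic_def by blast
    moreover have "c i j \<in> {1..m}"
    proof -
      have "Orb i \<subseteq> {1..m}"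
        using orbits_sym_group_subset[OF assms(2)] bij_betwE[OF assms(4)] i by blast
      then show ?thesis
        using bij_betwE[OF c] j by blast
    qed
    ultimately show "\<exists>g. switch_equiv V \<Gamma> f g \<and> (\<exists>i\<in>{1..m}. monochromatic V (a i) 2 g i)"
      using f'(1) by blast
  qed
  then show ?thesis
    unfolding switch_ramsey_alt by (rule Least_le)
qed

end
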